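(* Let $d\ge 2$, let $L\subset\mathbb{R}^d$ be a (full rank) lattice and let $V\in(0,2^d\det L]$. Then for all $K\in\mathcal{K}_L$ with $\operatorname{vol}K=V$ the inequality $\operatorname{diam}K_L(V)\le\operatorname{diam}K$ holds.
   Context: $\mathbb{R}^d$ carries the standard Euclidean norm $\|\cdot\|$. A (full rank) lattice is a set $L=A\mathbb{Z}^d$ with $A\in\mathrm{GL}_d(\mathbb{R})$, and $\det L=|\det A|$. $\mathcal{K}_L$ is the family of all centrally symmetric convex bodies $K$ (compact convex sets $K\subset\mathbb{R}^d$ with $K=-K$) that contain no non-zero point of $L$ in their interior. $\operatorname{vol}$ is $d$-dimensional Lebesgue measure and $\operatorname{diam}K=2\max_{x\in K}\|x\|$ for such $K$. $B_d(r)=\{x\in\mathbb{R}^d:\|x\|\le r\}$. The Dirichlet-Voronoi cell of a lattice $M$ is $\operatorname{DV}(M)=\{x\in\mathbb{R}^d:\|x\|\le\|x-y\|\text{ for all }y\in M\}$; $2L=\{2y:y\in L\}$. The covering radius of $L$ is $\mu(L)=\min\{\mu\in\mathbb{R}: L+B_d(\mu)=\mathbb{R}^d\}$. For $V\in(0,2^d\det L]$, $r_L(V)$ denotes the unique real number $r\in(0,2\mu(L)]$ such that $B_d(r)\cap\operatorname{DV}(2L)$ has volume $V$, and $K_L(V)=B_d(r_L(V))\cap\operatorname{DV}(2L)$. *)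

theory Defs
  imports "HOL-Analysis.Analysis"
begin

text \<open>
  Euclidean \<open>d\<close>-space is \<^typ>\<open>real^'n\<close> with \<open>d = CARD('n)\<close>.
\<close>

definition int_vectors :: "(real^'n) set" where
  "int_vectors = {x. \<forall>i. x $ i \<in> \<int>}"

definition lattice_of :: "real^'n^'n \<Rightarrow> (real^'n) set" where
  "lattice_of A = (\<lambda>x. A *v x) ` int_vectors"

definition full_rank_lattice :: "(real^'n) set \<Rightarrow> bool" where
  "full_rank_lattice L \<longleftrightarrow> (\<exists>A. invertible A \<and> L = lattice_of A)"

text \<open>Independence of the choice of the basis matrix is \<open>lattice_det_eq\<close> below.\<close>

definition lattice_det :: "(real^'n) set \<Rightarrow> real" where
  "lattice_det L = (THE D. \<exists>A. invertible A \<and> L = lattice_of A \<and> D = \<bar>det A\<bar>)"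

lemma Ints_det:
  fixes M :: "real^'n^'n"
  assumes "\<And>i j. M $ i $ j \<in> \<int>"
  shows "det M \<in> \<int>"
  unfolding det_def by (intro Ints_sum Ints_mult Ints_prod assms) auto

lemma abs_det_le_if_lattice_of_subset:
  fixes A B :: "real^'n^'n"
  assumes A: "invertible A" and B: "invertible B" and sub: "lattice_of B \<subseteq> lattice_of A"
  shows "\<bar>det A\<bar> \<le> \<bar>det B\<bar>"
proof -
  have "\<exists>y \<in> int_vectors. column j B = A *v y" for j
  proof -
    have "axis j (1::real) \<in> int_vectors"
      by (auto simp: int_vectors_def axis_def)
    then have "B *v axis j 1 \<in> lattice_of A"
      using sub by (auto simp: lattice_of_def)
    then show ?thesis
      by (auto simp: lattice_of_def matrix_vector_mul_component matrix_vector_mult_basis)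
  qed
  then obtain y where y: "\<And>j. y j \<in> int_vectors" "\<And>j. column j B = A *v y j"
    by metis
  define M :: "real^'n^'n" where "M = (\<chi> i j. y j $ i)"
  have "B = A ** M"
  proof -
    have "B $ i $ j = (A ** M) $ i $ j" for i j
    proof -
      have "B $ i $ j = column j B $ i" by (simp add: column_def)
      also have "\<dots> = (A ** M) $ i $ j"
        by (simp add: y(2) matrix_vector_mult_def matrix_matrix_mult_def M_def)
      finally show ?thesis .
    qed
    then show ?thesis by (simp add: vec_eq_iff)
  qed
  then have det: "det B = det A * det M" by (simp add: det_mul)
  have "det M \<in> \<int>"
    using y(1) by (intro Ints_det) (auto simp: M_def int_vectors_def)
  moreover have "det M \<noteq> 0"
    using B det by (auto simp: invertible_det_nz)
  ultimately have "1 \<le> \<bar>det M\<bar>" by (rule Ints_nonzero_abs_ge1)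
  then show ?thesis
    using mult_left_mono[of 1 "\<bar>det M\<bar>" "\<bar>det A\<bar>"] by (simp add: det abs_mult)
qed

lemma lattice_det_eq:
  assumes "invertible A"
  shows "lattice_det (lattice_of A) = \<bar>det A\<bar>"
  unfolding lattice_det_def
proof (rule the_equality)
  show "\<exists>A'. invertible A' \<and> lattice_of A = lattice_of A' \<and> \<bar>det A\<bar> = \<bar>det A'\<bar>"
    using assms by blast
next
  fix D
  assume "\<exists>A'. invertible A' \<and> lattice_of A = lattice_of A' \<and> D = \<bar>det A'\<bar>"
  then show "D = \<bar>det A\<bar>"
    using assms abs_det_le_if_lattice_of_subset by (metis order_antisym order_refl)
qed

definition lattice_free_bodies :: "(real^'n) set \<Rightarrow> (real^'n) set set" where
  "lattice_free_bodies L =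
     {K. compact K \<and> convex K \<and> uminus ` K = K \<and> interior K \<inter> L \<subseteq> {0}}"

definition dirichlet_voronoi :: "(real^'n) set \<Rightarrow> (real^'n) set" where
  "dirichlet_voronoi M = {x. \<forall>y\<in>M. norm x \<le> norm (x - y)}"

definition covering_radius :: "(real^'n) set \<Rightarrow> real" where
  "covering_radius L = (LEAST \<mu>. {x + b | x b. x \<in> L \<and> b \<in> cball 0 \<mu>} = UNIV)"

definition body_radius :: "(real^'n) set \<Rightarrow> real \<Rightarrow> real" where
  "body_radius L V =
     (THE r. 0 < r \<and> r \<le> 2 * covering_radius L \<and>
        measure lebesgue (cball 0 r \<inter> dirichlet_voronoi ((*\<^sub>R) 2 ` L)) = V)"

definition extremal_body :: "(real^'n) set \<Rightarrow> real \<Rightarrow> (real^'n) set" where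
  "extremal_body L V = cball 0 (body_radius L V) \<inter> dirichlet_voronoi ((*\<^sub>R) 2 ` L)"

text \<open>
  For the sets considered here the library's \<^const>\<open>diameter\<close> is twice the largest norm.
\<close>

lemma diameter_eq_twice_Sup_norm:
  fixes K :: "(real^'n) set"
  assumes "compact K" "K \<noteq> {}" "uminus ` K = K"
  shows "\<exists>x\<in>K. (\<forall>y\<in>K. norm y \<le> norm x) \<and> diameter K = 2 * norm x"
proof -
  obtain x where x: "x \<in> K" "\<forall>y\<in>K. norm y \<le> norm x"
    using continuous_attains_sup[OF assms(1,2), of norm] continuous_on_norm_id by blast
  have "diameter K \<le> 2 * norm x"
  proof (rule diameter_le)
    fix y z assume "y \<in> K" "z \<in> K"
    then show "norm (y - z) \<le> 2 * norm x"
      using bspec[OF x(2), of y] bspec[OF x(2), of z] norm_triangle_ineq4[of y z] by linarith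
  qed (use assms in auto)
  moreover have "- x \<in> K" using x(1) assms(3) by blast
  then have "dist x (- x) \<le> diameter K"
    using diameter_bounded_bound[OF compact_imp_bounded[OF assms(1)] x(1)] by blast
  then have "2 * norm x \<le> diameter K"
    by (simp add: dist_norm flip: scaleR_2)
  ultimately show ?thesis using x by force
qed

end

theory Submission
  imports Defs
begin

text \<open>
  Let \<open>R\<close> be half the diameter of \<open>K\<close>. Since \<open>K\<close> is symmetric and convex and
  has no non-zero lattice point in its interior, distinct points of the interior are incongruent
  modulo \<open>2L\<close>. Moving each of them by a vector of \<open>2L\<close> to a shortest representative of its
  class does not increase the norm, so it lands in \<open>cball 0 R \<inter> DV(2L)\<close>; hence this set has volume
  at least \<open>V\<close>. As \<open>r \<mapsto> vol (cball 0 r \<inter> DV(2L))\<close> is strictly increasing up to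
  \<open>r = 2 \<mu>(L)\<close>, the radius of the extremal body is at most \<open>R\<close>.
\<close>

subsection \<open>Volumes and incongruent points\<close>

text \<open>A volume version of the pigeonhole principle: cut \<open>S\<close> into countably many
  pieces according to the vector of \<open>M\<close> that moves a point into \<open>C\<close>. The
  moved pieces are disjoint, because a common point would come from two congruent points of
  \<open>S\<close>.\<close>

lemma measure_le_if_incongruent:
  fixes M S C :: "'a::euclidean_space set"
  assumes M: "countable M" and diff: "\<And>x y. x \<in> M \<Longrightarrow> y \<in> M \<Longrightarrow> x - y \<in> M"
    and S: "S \<in> lmeasurable" and C: "C \<in> lmeasurable"
    and inj: "\<And>x y. x \<in> S \<Longrightarrow> y \<in> S \<Longrightarrow> x - y \<in> M \<Longrightarrow> x = y"
    and cover: "\<And>x. x \<in> S \<Longrightarrow> \<exists>y\<in>M. x - y \<in> C"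
  shows "measure lebesgue S \<le> measure lebesgue C"
proof -
  \<comment> \<open>\<open>T n\<close> consists of the points of \<open>S\<close> that the vector
    with index \<open>n\<close> moves into \<open>C\<close>, and \<open>D n\<close> of their
    translates in \<open>C\<close>. The \<open>T n\<close> may overlap, as a point can have several
    translates in \<open>C\<close>, so they enter by subadditivity; the \<open>D n\<close> are
    disjoint and enter by additivity. Both are empty if \<open>n\<close> is not an index.\<close>
  define T where "T n = {x \<in> S. \<exists>y\<in>M. to_nat_on M y = n \<and> x - y \<in> C}" for n
  define D where "D n = {x \<in> C. \<exists>y\<in>M. to_nat_on M y = n \<and> x + y \<in> S}" for n
  have TD: "T n \<in> lmeasurable \<and> D n \<in> lmeasurable \<and> measure lebesgue (T n) = measure lebesgue (D n)" for n
  proof (cases "\<exists>y\<in>M. to_nat_on M y = n")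
    case True
    then obtain y where y: "y \<in> M" "to_nat_on M y = n" by blast
    have uniq: "z \<in> M \<Longrightarrow> to_nat_on M z = n \<longleftrightarrow> z = y" for z
      using y M by auto
    have T: "T n = S \<inter> (+) y ` C"
    proof (intro set_eqI iffI)
      fix x assume "x \<in> T n"
      then show "x \<in> S \<inter> (+) y ` C"
        using uniq unfolding T_def by (auto intro!: image_eqI[of _ _ "x - y"])
    next
      fix x assume "x \<in> S \<inter> (+) y ` C"
      then show "x \<in> T n" using y unfolding T_def by auto
    qed
    have TDn: "T n = (+) y ` D n"
      unfolding T using uniq y by (auto simp: D_def add.commute)
    have D: "D n = (\<lambda>x. x - y) ` T n"
      unfolding TDn by (simp add: image_image)
    have "T n \<in> lmeasurable"
      unfolding T by (intro fmeasurable.Int S measurable_translation C)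
    then show ?thesis
      using measurable_translation_subtract[of "T n" y] D
      by (simp add: measure_translation_subtract)
  next
    case False
    then show ?thesis by (auto simp: T_def D_def)
  qed
  have disj: "disjoint_family D"
    unfolding disjoint_family_on_def
  proof (safe, goal_cases)
    case (1 m n x)
    then obtain y z where yz: "y \<in> M" "to_nat_on M y = m" "x + y \<in> S"
      "z \<in> M" "to_nat_on M z = n" "x + z \<in> S" by (auto simp: D_def)
    have "(x + y) - (x + z) \<in> M" using diff[OF yz(1,4)] by simp
    then have "x + y = x + z" using inj yz by blast
    then show ?case using 1 yz by auto
  qed
  have em: "emeasure lebesgue (T n) = emeasure lebesgue (D n)" for n
    using TD[of n] by (simp add: emeasure_eq_measure2)
  have sets: "range T \<subseteq> sets lebesgue" "range D \<subseteq> sets lebesgue"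
    using TD by auto
  have "S \<subseteq> (\<Union>n. T n)" using cover by (fastforce simp: T_def)
  then have "emeasure lebesgue S \<le> emeasure lebesgue (\<Union>n. T n)"
    using sets by (intro emeasure_mono) auto
  also have "\<dots> \<le> (\<Sum>n. emeasure lebesgue (T n))"
    by (rule emeasure_subadditive_countably[OF sets(1)])
  also have "\<dots> = (\<Sum>n. emeasure lebesgue (D n))" by (simp add: em)
  also have "\<dots> = emeasure lebesgue (\<Union>n. D n)"
    by (rule suminf_emeasure[OF sets(2) disj])
  also have "\<dots> \<le> emeasure lebesgue C"
    using C by (intro emeasure_mono) (auto simp: D_def)
  finally show ?thesis
    using S C by (simp add: emeasure_eq_measure2)
qed

text \<open>A swap of coordinates sends a box to a box with permuted side lengths. This is one of
  the elementary cases for general linear maps below.\<close>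

lemma measure_swap_cbox:
  fixes a b :: "real^'n"
  shows "measure lebesgue ((\<lambda>x. \<chi> i. x $ Transposition.transpose m n i) ` cbox a b)
    = measure lebesgue (cbox a b)"
proof -
  let ?h = "\<lambda>x::real^'n. \<chi> i. x $ Transposition.transpose m n i"
  have inv: "?h (?h x) = x" for x by (simp add: vec_eq_iff)
  have mem: "?h x \<in> cbox (?h u) (?h v) \<longleftrightarrow> x \<in> cbox u v" for x u v
    by (simp add: mem_box_cart) (metis transpose_involutory)
  have eq: "?h ` cbox a b = cbox (?h a) (?h b)"
  proof (intro set_eqI iffI)
    fix x assume "x \<in> cbox (?h a) (?h b)"
    then show "x \<in> ?h ` cbox a b"
      using mem[of "?h x" a b] inv[of x] by (auto intro!: image_eqI[of _ _ "?h x"])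
  qed (use mem in auto)
  then have "cbox (?h a) (?h b) = {} \<longleftrightarrow> cbox a b = {}"
    by (metis image_is_empty)
  moreover have "(\<Prod>i\<in>UNIV. (b - a) $ Transposition.transpose m n i) = (\<Prod>i\<in>UNIV. (b - a) $ i)"
    using prod.permute[OF permutes_swap_id, where S=UNIV and g="\<lambda>i. (b - a) $ i"]
    by (simp add: o_def)
  ultimately show ?thesis
    by (simp add: eq content_cbox_if_cart)
qed

lemma measure_shear_cbox:
  fixes a b :: "real^'n"
  assumes "m \<noteq> n"
  shows "measure lebesgue ((\<lambda>x. \<chi> i. if i = m then x $ m + x $ n else x $ i) ` cbox a b)
    = measure lebesgue (cbox a b)"
proof (cases "cbox a b = {}")
  case False
  let ?h = "\<lambda>x::real^'n. \<chi> i. if i = m then x $ m + x $ n else x $ i"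
  \<comment> \<open>Moving the lower corner to the origin makes its coordinates non-negative, as
    \<open>measure_shear_interval\<close> demands; a shear turns a translation by \<open>a\<close>
    into one by the image of \<open>a\<close>.\<close>
  have cbox: "cbox a b = (+) a ` cbox 0 (b - a)"
    by (simp add: cbox_translation[of a, symmetric])
  have "?h ` (+) a ` S = (+) (?h a) ` ?h ` S" for S
    by (auto simp: image_image vec_eq_iff intro!: image_cong)
  then have "measure lebesgue (?h ` cbox a b) = measure lebesgue (?h ` cbox 0 (b - a))"
    by (simp only: cbox measure_translation)
  also have "\<dots> = measure lebesgue (cbox 0 (b - a))"
    using assms False cbox by (intro measure_shear_interval) auto
  also have "\<dots> = measure lebesgue (cbox a b)"
    by (simp only: cbox measure_translation)
  finally show ?thesis .
qed simp

text \<open>The library's \<open>measure_linear_image\<close> requires a well-ordered index type.\<close>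

lemma measure_linear_image_cart:
  fixes f :: "real^'n \<Rightarrow> real^'n"
  assumes "linear f" "S \<in> lmeasurable"
  shows "f ` S \<in> lmeasurable \<and> measure lebesgue (f ` S) = \<bar>det (matrix f)\<bar> * measure lebesgue S"
proof -
  define P where "P f \<longleftrightarrow> (\<forall>S\<in>lmeasurable. f ` S \<in> lmeasurable \<and>
      measure lebesgue (f ` S) = \<bar>det (matrix f)\<bar> * measure lebesgue S)" for f :: "real^'n \<Rightarrow> real^'n"
  \<comment> \<open>For swaps and shears the determinant factor is 1, and preserving the volume of
    boxes is enough to preserve that of all measurable sets.\<close>
  have boxes: "P f" if "linear f" "\<bar>det (matrix f)\<bar> = 1"
    "\<And>a b. measure lebesgue (f ` cbox a b) = measure lebesgue (cbox a b)" for f :: "real^'n \<Rightarrow> real^'n"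
    unfolding P_def that(2)
  proof
    fix S :: "(real^'n) set" assume S: "S \<in> lmeasurable"
    have "f ` S \<in> lmeasurable \<and> 1 * measure lebesgue S = measure lebesgue (f ` S)"
      by (rule measure_linear_sufficient[OF that(1) S]) (simp only: that(3) mult_1)
    then show "f ` S \<in> lmeasurable \<and> measure lebesgue (f ` S) = 1 * measure lebesgue S"
      by metis
  qed
  have "P f"
    using assms(1)
  proof (rule induct_linear_elementary)
    fix f g :: "real^'n \<Rightarrow> real^'n"
    assume fg: "linear f" "linear g" "P f" "P g"
    have "(f \<circ> g) ` S = f ` (g ` S)" for S by auto
    then show "P (f \<circ> g)"
      using fg(3,4) unfolding P_def matrix_compose[OF fg(2,1)] by (simp only: det_mul abs_mult mult.assoc) metis
  next
    fix f :: "real^'n \<Rightarrow> real^'n" and i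
    assume f: "linear f" and "\<And>x. f x $ i = 0"
    \<comment> \<open>The all-ones vector is missed, so the map is singular and both sides of the
      volume formula vanish.\<close>
    then have "f x \<noteq> 1" for x by (metis one_index zero_neq_one)
    then have "\<not> surj f" by (metis surjD)
    then have "\<not> inj f" using linear_injective_imp_surjective[OF f] by blast
    then have "negligible (f ` S)" "det (matrix f) = 0" for S
      using negligible_linear_singular_image[OF f] det_nz_iff_inj[OF f] by blast+
    then show "P f"
      by (simp add: P_def flip: negligible_iff_measure)
  next
    fix c :: "'n \<Rightarrow> real"
    have "det (matrix (\<lambda>x. \<chi> i. c i * x $ i)) = prod c UNIV"
      by (subst det_diagonal) (auto simp: matrix_def axis_def)
    then show "P (\<lambda>x. \<chi> i. c i * x $ i)"
      by (simp add: P_def measurable_stretch measure_stretch)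
  next
    fix m n :: 'n
    let ?h = "\<lambda>x::real^'n. \<chi> i. x $ Transposition.transpose m n i"
    have "matrix ?h = (\<chi> i. mat 1 $ Transposition.transpose m n i)"
      by (simp add: matrix_def mat_def axis_def vec_eq_iff)
    then have "\<bar>det (matrix ?h)\<bar> = 1"
      by (simp add: det_permute_rows permutes_swap_id sign_swap_id abs_mult)
    moreover have "linear ?h"
      by (rule linearI) (simp_all add: vec_eq_iff)
    ultimately show "P ?h" using measure_swap_cbox by (intro boxes) auto
  next
    fix m n :: 'n
    assume "m \<noteq> n"
    let ?h = "\<lambda>x::real^'n. \<chi> i. if i = m then x $ m + x $ n else x $ i"
    have "matrix ?h = (\<chi> k. if k = m then row m (mat 1) + 1 *s row n (mat 1) else row k (mat 1))"
      by (simp add: matrix_def mat_def axis_def row_def vec_eq_iff)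
    then have "det (matrix ?h) = 1"
      by (simp only: det_row_operation[OF \<open>m \<noteq> n\<close>] det_I)
    moreover have "linear ?h"
      by (rule linearI) (simp_all add: vec_eq_iff algebra_simps)
    ultimately show "P ?h" using measure_shear_cbox[OF \<open>m \<noteq> n\<close>] by (intro boxes) auto
  qed
  with assms(2) show ?thesis by (simp add: P_def)
qed

subsection \<open>Lattices\<close>

lemma countable_lattice_of: "countable (lattice_of A)"
proof -
  have "countable (int_vectors :: (real^'n) set)"
  proof (rule countable_subset)
    show "(int_vectors :: (real^'n) set) \<subseteq> (\<lambda>f. \<chi> i. of_int (f i)) ` (UNIV :: ('n \<Rightarrow> int) set)"
    proof
      fix x :: "real^'n" assume "x \<in> int_vectors"
      then have "x = (\<chi> i. of_int \<lfloor>x $ i\<rfloor>)"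
        by (simp add: int_vectors_def vec_eq_iff)
      then show "x \<in> (\<lambda>f. \<chi> i. of_int (f i)) ` (UNIV :: ('n \<Rightarrow> int) set)"
        by (rule image_eqI[of _ _ "\<lambda>i. \<lfloor>x $ i\<rfloor>"]) simp
    qed
  qed auto
  then show ?thesis by (auto simp: lattice_of_def)
qed

lemma zero_in_lattice_of: "0 \<in> lattice_of A"
  by (auto simp: lattice_of_def int_vectors_def intro!: image_eqI[of _ _ 0])

lemma diff_in_lattice_of:
  "x \<in> lattice_of A \<Longrightarrow> y \<in> lattice_of A \<Longrightarrow> x - y \<in> lattice_of A"
  by (auto simp: lattice_of_def int_vectors_def matrix_vector_mult_diff_distrib[symmetric])

lemma closed_lattice_of:
  assumes "invertible (A :: real^'n^'n)"
  shows "closed (lattice_of A)"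
proof -
  have "closed (\<Inter>i. (\<lambda>x::real^'n. x $ i) -` \<int>)"
    by (intro closed_INT ballI closed_vimage continuous_intros) auto
  also have "(\<Inter>i. (\<lambda>x::real^'n. x $ i) -` \<int>) = int_vectors"
    by (auto simp: int_vectors_def)
  finally have "closed (int_vectors :: (real^'n) set)" .
  then show ?thesis
    unfolding lattice_of_def
    using assms by (intro closed_injective_linear_image) (auto simp: inj_matrix_vector_mult)
qed

text \<open>A non-zero integer vector has a coordinate of absolute value at least 1, and an
  injective linear map shrinks norms by at most a constant factor.\<close>

lemma lattice_of_norm_bounded_below:
  assumes "invertible (A :: real^'n^'n)"
  obtains c where "c > 0" "\<And>y. y \<in> lattice_of A \<Longrightarrow> y \<noteq> 0 \<Longrightarrow> c \<le> norm y"
proof -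
  obtain c where c: "c > 0" "\<And>x. c * norm x \<le> norm (A *v x)"
    using linear_inj_bounded_below_pos[of "(*v) A"] assms inj_matrix_vector_mult
    by (metis matrix_vector_mul_linear mult.commute)
  have "c \<le> norm y" if "y \<in> lattice_of A" "y \<noteq> 0" for y
  proof -
    obtain x where x: "x \<in> int_vectors" "y = A *v x" "x \<noteq> 0"
      using \<open>y \<in> lattice_of A\<close> \<open>y \<noteq> 0\<close> unfolding lattice_of_def
      by (metis (no_types, lifting) imageE matrix_vector_mult_0_right)
    then obtain i where "x $ i \<noteq> 0" by (auto simp: vec_eq_iff)
    then have "1 \<le> \<bar>x $ i\<bar>"
      using x by (intro Ints_nonzero_abs_ge1) (auto simp: int_vectors_def)
    also have "\<dots> \<le> norm x" by (rule component_le_norm_cart)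
    finally have "c * 1 \<le> c * norm x" using c(1) by (intro mult_left_mono) auto
    then show ?thesis using c(2)[of x] x(2) by simp
  qed
  with c that show ?thesis by blast
qed

lemma lattice_of_covering:
  assumes "invertible (A :: real^'n^'n)"
  obtains c where "\<And>x. \<exists>y\<in>lattice_of A. norm (x - y) \<le> c"
proof -
  have "compact ((*v) A ` cbox 0 1)"
    by (intro compact_continuous_image compact_cbox linear_continuous_on) auto
  then obtain c where c: "\<And>x. x \<in> cbox 0 1 \<Longrightarrow> norm (A *v x) \<le> c"
    using compact_imp_bounded bounded_iff by (metis imageI)
  have "\<exists>y\<in>lattice_of A. norm (x - y) \<le> c" for x
  proof -
    obtain v where v: "x = A *v v"
      using assms invertible_eq_bij by (metis bij_pointE)
    \<comment> \<open>Rounding the basis coordinates down leaves a remainder in the image of the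
      unit cube, which is bounded.\<close>
    define w :: "real^'n" where "w = (\<chi> i. of_int \<lfloor>v $ i\<rfloor>)"
    have "A *v w \<in> lattice_of A" by (auto simp: lattice_of_def int_vectors_def w_def)
    moreover have "norm (x - A *v w) \<le> c"
      unfolding v matrix_vector_mult_diff_distrib[symmetric]
      by (rule c) (auto simp: mem_box_cart w_def, linarith+)
    ultimately show ?thesis by blast
  qed
  with that show ?thesis by blast
qed

lemma scaled_lattice_of: "(*\<^sub>R) c ` lattice_of A = lattice_of (c *\<^sub>R A)"
  by (simp add: lattice_of_def image_image scaleR_matrix_vector_assoc)

lemma det_scaleR: "det (c *\<^sub>R A) = c ^ CARD('n) * det (A :: real^'n^'n)"
proof -
  have "c *\<^sub>R A = (\<chi> i. c *s A $ i)"
    by (simp add: vec_eq_iff)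
  then show ?thesis
    using det_rows_mul[of "\<lambda>_. c" "\<lambda>i. A $ i"] by simp
qed

subsection \<open>Dirichlet-Voronoi cells\<close>

text \<open>After squaring, the terms \<open>x \<bullet> x\<close> cancel and each condition becomes
  linear in \<open>x\<close>; convexity and closedness follow at once.\<close>

lemma dirichlet_voronoi_eq_halfspaces:
  "dirichlet_voronoi M = (\<Inter>y\<in>M. {x. (2 *\<^sub>R y) \<bullet> x \<le> y \<bullet> y})"
  by (auto simp: dirichlet_voronoi_def norm_le inner_diff inner_commute)

lemma convex_dirichlet_voronoi: "convex (dirichlet_voronoi M)"
  unfolding dirichlet_voronoi_eq_halfspaces
  by (intro convex_INT convex_halfspace_le)

lemma closed_dirichlet_voronoi: "closed (dirichlet_voronoi M)"
  unfolding dirichlet_voronoi_eq_halfspaces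
  by (intro closed_INT ballI closed_halfspace_le)

lemma dirichlet_voronoi_scaleR:
  assumes "c > 0"
  shows "dirichlet_voronoi ((*\<^sub>R) c ` M) = (*\<^sub>R) c ` dirichlet_voronoi M"
proof -
  have *: "c *\<^sub>R x \<in> dirichlet_voronoi ((*\<^sub>R) c ` M) \<longleftrightarrow> x \<in> dirichlet_voronoi M" for x
    using assms by (simp add: dirichlet_voronoi_def scaleR_diff_right[symmetric])
  show ?thesis
  proof (intro set_eqI iffI)
    fix x assume "x \<in> dirichlet_voronoi ((*\<^sub>R) c ` M)"
    then show "x \<in> (*\<^sub>R) c ` dirichlet_voronoi M"
      using *[of "x /\<^sub>R c"] assms by (auto intro!: image_eqI[of _ _ "x /\<^sub>R c"])
  qed (use * in auto)
qed

lemma interior_dirichlet_voronoi_lattice_of: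
  assumes "invertible (A :: real^'n^'n)"
  shows "0 \<in> interior (dirichlet_voronoi (lattice_of A))"
proof -
  obtain c where c: "c > 0" "\<And>y. y \<in> lattice_of A \<Longrightarrow> y \<noteq> 0 \<Longrightarrow> c \<le> norm y"
    using lattice_of_norm_bounded_below[OF assms] by metis
  \<comment> \<open>With \<open>c\<close> a lower bound for the non-zero lattice norms, a point of
    norm below \<open>c/2\<close> has distance more than \<open>c/2\<close> from every non-zero
    lattice point.\<close>
  have "ball 0 (c/2) \<subseteq> dirichlet_voronoi (lattice_of A)"
  proof (clarsimp simp: dirichlet_voronoi_def)
    fix x y :: "real^'n" assume x: "norm x * 2 < c" and y: "y \<in> lattice_of A"
    show "norm x \<le> norm (x - y)"
    proof (cases "y = 0")
      case False
      with c y have "c \<le> norm y" by blast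
      with x show ?thesis using norm_triangle_ineq4[of x "x - y"] by simp
    qed simp
  qed
  then show ?thesis using c by (meson centre_in_ball half_gt_zero interior_maximal open_ball subsetD)
qed

lemma compact_dirichlet_voronoi_lattice_of:
  assumes "invertible (A :: real^'n^'n)"
  shows "compact (dirichlet_voronoi (lattice_of A))"
proof -
  obtain c where c: "\<And>x. \<exists>y\<in>lattice_of A. norm (x - y) \<le> c"
    using lattice_of_covering[OF assms] by blast
  \<comment> \<open>In the cell, \<open>norm x\<close> is at most the distance from \<open>x\<close>
    to any lattice point, and some lattice point is within \<open>c\<close>.\<close>
  have "norm x \<le> c" if "x \<in> dirichlet_voronoi (lattice_of A)" for x
    using c[of x] that unfolding dirichlet_voronoi_def by force
  then have "bounded (dirichlet_voronoi (lattice_of A))"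
    by (auto simp: bounded_iff)
  then show ?thesis
    by (simp add: closed_dirichlet_voronoi compact_eq_bounded_closed)
qed

text \<open>Take for \<open>y\<close> a lattice point nearest to \<open>x\<close>, which exists
  since the lattice is closed. Comparing \<open>y\<close> with \<open>y + z\<close> puts
  \<open>x - y\<close> into the cell; comparing it with 0 bounds the norm.\<close>

lemma lattice_of_reduction:
  assumes "invertible (A :: real^'n^'n)"
  obtains y where "y \<in> lattice_of A" "x - y \<in> dirichlet_voronoi (lattice_of A)"
    "norm (x - y) \<le> norm x"
proof -
  obtain y where y: "y \<in> lattice_of A" "\<And>z. z \<in> lattice_of A \<Longrightarrow> dist x y \<le> dist x z"
  proof (rule distance_attains_inf[OF closed_lattice_of[OF assms], where a = x])
    show "lattice_of A \<noteq> {}" using zero_in_lattice_of by blast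
  qed blast
  have "norm (x - y) \<le> norm (x - y - z)" if z: "z \<in> lattice_of A" for z
  proof -
    have "y - (0 - z) \<in> lattice_of A"
      by (intro diff_in_lattice_of y z zero_in_lattice_of)
    from y(2)[OF this] show ?thesis by (simp add: dist_norm algebra_simps)
  qed
  then have "x - y \<in> dirichlet_voronoi (lattice_of A)" by (simp add: dirichlet_voronoi_def)
  moreover have "norm (x - y) \<le> norm x"
    using y(2)[OF zero_in_lattice_of] by (simp add: dist_norm)
  ultimately show ?thesis using that y(1) by blast
qed

text \<open>The covering radius is the largest norm in the cell: a farthest point \<open>p\<close>
  of the cell has distance at least \<open>norm p\<close> from the whole lattice, while every point
  reduces to one in the cell. In particular the \<open>LEAST\<close> is attained.\<close>

lemma covering_radius_lattice_of:
  assumes "invertible (A :: real^'n^'n)"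
  obtains p where "p \<in> dirichlet_voronoi (lattice_of A)" "norm p = covering_radius (lattice_of A)"
    "\<And>x. x \<in> dirichlet_voronoi (lattice_of A) \<Longrightarrow> norm x \<le> covering_radius (lattice_of A)"
proof -
  let ?L = "lattice_of A"
  have "dirichlet_voronoi ?L \<noteq> {}"
    by (auto simp: dirichlet_voronoi_def intro!: exI[of _ 0])
  then obtain p where p: "p \<in> dirichlet_voronoi ?L" "\<And>x. x \<in> dirichlet_voronoi ?L \<Longrightarrow> norm x \<le> norm p"
    using continuous_attains_sup[OF compact_dirichlet_voronoi_lattice_of[OF assms], of norm]
      continuous_on_norm_id by blast
  have "{x + b |x b. x \<in> ?L \<and> b \<in> cball 0 \<mu>} = UNIV \<longleftrightarrow> norm p \<le> \<mu>" (is "?U = _ \<longleftrightarrow> _") for \<mu>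
  proof
    assume "?U = UNIV"
    then have "p \<in> ?U" by simp
    then obtain x b where "p = x + b" "x \<in> ?L" "norm b \<le> \<mu>" by auto
    then show "norm p \<le> \<mu>" using p(1) by (force simp: dirichlet_voronoi_def)
  next
    assume "norm p \<le> \<mu>"
    have "x \<in> ?U" for x
    proof -
      obtain y where "y \<in> ?L" "x - y \<in> dirichlet_voronoi ?L"
        using lattice_of_reduction[OF assms] by metis
      then show ?thesis
        using p(2)[of "x - y"] \<open>norm p \<le> \<mu>\<close>
        by (intro CollectI exI[of _ y] exI[of _ "x - y"]) auto
    qed
    then show "?U = UNIV" by blast
  qed
  then have "covering_radius ?L = norm p"
    unfolding covering_radius_def by (simp add: Least_equality)
  with p that show ?thesis by simp
qed

text \<open>The points of an open fundamental parallelepiped are pairwise incongruent, and each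
  reduces into the cell. Applied to \<open>2 *\<^sub>R A\<close>, this shows that the cell has room
  for every admissible volume \<open>V\<close>.\<close>

lemma abs_det_le_measure_dirichlet_voronoi:
  assumes "invertible (A :: real^'n^'n)"
  shows "\<bar>det A\<bar> \<le> measure lebesgue (dirichlet_voronoi (lattice_of A))"
proof -
  \<comment> \<open>The box is open because opposite faces of the closed one are congruent; the
    frontier has volume 0.\<close>
  let ?P = "(*v) A ` box 0 1"
  have box: "box (0::real^'n) 1 \<in> lmeasurable" by simp
  have "measure lebesgue ?P = \<bar>det A\<bar> * measure lebesgue (box (0::real^'n) 1)"
    using measure_linear_image_cart[OF matrix_vector_mul_linear box, of A] by simp
  also have "measure lebesgue (box (0::real^'n) 1) = measure lebesgue (cbox (0::real^'n) 1)"
    using measure_interior[of "cbox (0::real^'n) 1"]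
    by (simp add: interior_cbox negligible_convex_frontier)
  also have "\<dots> = 1"
    by (simp add: content_cbox_if_cart interval_eq_empty_cart)
  finally have "\<bar>det A\<bar> = measure lebesgue ?P" by simp
  also have "\<dots> \<le> measure lebesgue (dirichlet_voronoi (lattice_of A))"
  proof (rule measure_le_if_incongruent[OF countable_lattice_of])
    show "?P \<in> lmeasurable"
      using measure_linear_image_cart[OF matrix_vector_mul_linear box, of A] by simp
    show "dirichlet_voronoi (lattice_of A) \<in> lmeasurable"
      by (intro lmeasurable_compact compact_dirichlet_voronoi_lattice_of assms)
    show "\<exists>y\<in>lattice_of A. x - y \<in> dirichlet_voronoi (lattice_of A)" for x
      using lattice_of_reduction[OF assms] by metis
    show "x = y" if xy: "x \<in> ?P" "y \<in> ?P" "x - y \<in> lattice_of A" for x y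
    proof -
      obtain u v where uv: "x = A *v u" "y = A *v v" "u \<in> box 0 1" "v \<in> box 0 1"
        using xy by auto
      obtain w where w: "w \<in> int_vectors" "A *v (u - v) = A *v w"
        using xy uv by (auto simp: lattice_of_def matrix_vector_mult_diff_distrib)
      then have "u - v = w"
        using assms inj_matrix_vector_mult by (metis injD)
      have "u $ i = v $ i" for i
      proof -
        have "(u - v) $ i \<in> \<int>"
          using w \<open>u - v = w\<close> by (simp add: int_vectors_def)
        moreover have "\<bar>(u - v) $ i\<bar> < 1"
          using uv(3,4) by (auto simp: mem_box_cart abs_less_iff dest!: spec[of _ i])
        ultimately show ?thesis
          using Ints_nonzero_abs_less1 by fastforce
      qed
      then have "u = v" by (simp add: vec_eq_iff)
      then show ?thesis using uv by simp
    qed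
  qed (rule diff_in_lattice_of)
  finally show ?thesis .
qed

subsection \<open>Intersections with concentric balls\<close>

text \<open>The part of \<open>D\<close> between two radii lies in a spherical shell, so the
  increments are dominated by those of the ball volume.\<close>

lemma continuous_on_measure_cball_Int:
  fixes D :: "'a::euclidean_space set"
  assumes D: "closed D"
  shows "continuous_on {0..} (\<lambda>r. measure lebesgue (cball 0 r \<inter> D))" (is "continuous_on _ ?f")
proof -
  define g where "g r = measure lebesgue (cball (0::'a) r)" for r
  have "continuous_on {0..} (\<lambda>r. unit_ball_vol (DIM('a)) * r ^ DIM('a))"
    by (intro continuous_intros)
  then have g: "continuous_on {0..} g"
    by (rule continuous_on_eq) (simp add: g_def content_cball)
  have lm: "cball 0 r \<inter> D \<in> lmeasurable" for r
    using D by (intro lmeasurable_compact) auto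
  have mono: "0 \<le> ?f s - ?f r \<and> ?f s - ?f r \<le> g s - g r" if "r \<le> s" for r s
  proof
    show "0 \<le> ?f s - ?f r"
      using that lm by (auto intro!: measure_mono_fmeasurable)
    have "?f s - ?f r = measure lebesgue (cball 0 s \<inter> D - cball 0 r \<inter> D)"
      using that lm by (intro measurable_measure_Diff[symmetric]) (auto simp: fmeasurableD)
    also have "\<dots> \<le> measure lebesgue (cball (0::'a) s - cball 0 r)"
      using lm by (intro measure_mono_fmeasurable) (auto intro!: fmeasurable.Diff)
    also have "\<dots> = g s - g r"
      unfolding g_def using that by (intro measurable_measure_Diff) auto
    finally show "?f s - ?f r \<le> g s - g r" .
  qed
  have "\<bar>?f s - ?f r\<bar> \<le> \<bar>g s - g r\<bar>" for r s
    using mono[of r s] mono[of s r] by (cases "r \<le> s") auto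
  then show ?thesis
    using g unfolding continuous_on_iff dist_real_def by (meson le_less_trans)
qed

text \<open>The point \<open>p\<close> shows that \<open>D\<close> reaches out to radius
  \<open>s\<close>, so the open shell between \<open>r\<close> and \<open>s\<close> meets the
  interior of \<open>D\<close> in a non-empty open set.\<close>

lemma measure_cball_Int_strict_mono:
  fixes D :: "'a::euclidean_space set"
  assumes D: "closed D" "convex D" "0 \<in> interior D" and p: "p \<in> D" "s \<le> norm p"
    and rs: "0 \<le> r" "r < s"
  shows "measure lebesgue (cball 0 r \<inter> D) < measure lebesgue (cball 0 s \<inter> D)"
proof -
  have lm: "cball 0 r \<inter> D \<in> lmeasurable" for r
    using D by (intro lmeasurable_compact) auto
  define U where "U = interior D \<inter> (ball 0 s - cball 0 r)"
  \<comment> \<open>The point of norm \<open>(r + s) / 2\<close> on the segment from 0 to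
    \<open>p\<close>; it is interior because 0 is.\<close>
  define q where "q = ((r + s) / 2 / norm p) *\<^sub>R p"
  have "norm p > 0" using p rs by linarith
  have "p - (1 - (r + s) / 2 / norm p) *\<^sub>R (p - 0) \<in> interior D"
    using D p rs \<open>norm p > 0\<close> by (intro mem_interior_convex_shrink) (auto simp: field_simps)
  then have "q \<in> interior D" by (simp add: q_def algebra_simps)
  moreover have "norm q = (r + s) / 2"
    using \<open>norm p > 0\<close> rs by (simp add: q_def)
  ultimately have "q \<in> U" using rs by (simp add: U_def)
  moreover have "open U" by (auto simp: U_def intro!: open_Diff)
  ultimately have "\<not> negligible U" by (metis open_not_negligible empty_iff)
  moreover have U: "U \<in> lmeasurable"
    using \<open>open U\<close> by (intro lmeasurable_open) (auto simp: U_def intro: bounded_subset[of "ball 0 s"])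
  ultimately have pos: "0 < measure lebesgue U"
    using negligible_iff_measure zero_less_measure_iff by (metis order_le_less measure_nonneg)
  have "measure lebesgue (cball 0 r \<inter> D) + measure lebesgue U = measure lebesgue ((cball 0 r \<inter> D) \<union> U)"
  proof -
    have "cball 0 r \<inter> D \<inter> U = {}" by (auto simp: U_def)
    then show ?thesis using measure_Un3[OF lm U, of r] by simp
  qed
  also have "\<dots> \<le> measure lebesgue (cball 0 s \<inter> D)"
    using lm U rs interior_subset[of D] by (intro measure_mono_fmeasurable) (auto simp: U_def)
  finally show ?thesis using pos by linarith
qed

text \<open>The \<open>THE\<close> in \<open>body_radius\<close> is justified here: existence by the
  intermediate value theorem, uniqueness by strict monotonicity. The point \<open>p\<close>
  certifies that the cell reaches as far as the radius, so that strict monotonicity can be used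
  again.\<close>

lemma measure_body_radius:
  assumes A: "invertible (A :: real^'n^'n)" and V: "0 < V" "V \<le> 2 ^ CARD('n) * \<bar>det A\<bar>"
  defines "D \<equiv> dirichlet_voronoi ((*\<^sub>R) 2 ` lattice_of A)"
  obtains p where "p \<in> D" "body_radius (lattice_of A) V \<le> norm p" "0 < body_radius (lattice_of A) V"
    "measure lebesgue (cball 0 (body_radius (lattice_of A) V) \<inter> D) = V"
proof -
  let ?f = "\<lambda>r. measure lebesgue (cball 0 r \<inter> D)"
  let ?\<rho> = "2 * covering_radius (lattice_of A)"
  have inv2: "invertible (2 *\<^sub>R A)" using A by (simp add: invertible_det_nz det_scaleR)
  have D: "D = dirichlet_voronoi (lattice_of (2 *\<^sub>R A))"
    by (simp add: D_def scaled_lattice_of)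
  have D2: "D = (*\<^sub>R) 2 ` dirichlet_voronoi (lattice_of A)"
    by (simp add: D_def dirichlet_voronoi_scaleR)
  obtain p where p: "p \<in> D" "norm p = ?\<rho>" "\<And>x. x \<in> D \<Longrightarrow> norm x \<le> ?\<rho>"
  proof -
    obtain q where "q \<in> dirichlet_voronoi (lattice_of A)" "norm q = covering_radius (lattice_of A)"
    "\<And>x. x \<in> dirichlet_voronoi (lattice_of A) \<Longrightarrow> norm x \<le> covering_radius (lattice_of A)"
      using covering_radius_lattice_of[OF A] by metis
    then show ?thesis
      by (intro that[of "2 *\<^sub>R q"]) (auto simp: D2)
  qed
  \<comment> \<open>The cell of \<open>2L\<close> has largest norm \<open>2 \<mu>(L)\<close>, so at
    this radius the ball contains the whole cell and the volume is at least
    \<open>V\<close>.\<close>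
  have "cball 0 ?\<rho> \<inter> D = D" using p by auto
  then have "V \<le> ?f ?\<rho>"
    using abs_det_le_measure_dirichlet_voronoi[OF inv2] V by (simp add: D det_scaleR abs_mult)
  moreover have "?f 0 = 0"
  proof -
    have "negligible (cball 0 0 \<inter> D)" by (rule negligible_subset[of "{0}"]) auto
    then show ?thesis by (simp add: negligible_imp_measure0)
  qed
  moreover have "continuous_on {0..?\<rho>} ?f"
    by (rule continuous_on_subset[OF continuous_on_measure_cball_Int])
      (auto simp: D closed_dirichlet_voronoi)
  ultimately obtain r where r: "0 \<le> r" "r \<le> ?\<rho>" "?f r = V"
    using IVT'[of ?f 0 V ?\<rho>] V p(2) norm_ge_zero[of p] by auto
  have "r \<noteq> 0" using r \<open>?f 0 = 0\<close> V by auto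
  have uniq: "s = r" if s: "0 < s" "s \<le> ?\<rho>" "?f s = V" for s
  proof -
    have "?f a < ?f b" if "0 \<le> a" "a < b" "b \<le> ?\<rho>" for a b
      using p that interior_dirichlet_voronoi_lattice_of[OF inv2]
      by (intro measure_cball_Int_strict_mono[of D p])
        (auto simp: D closed_dirichlet_voronoi convex_dirichlet_voronoi)
    from this[of r s] this[of s r] show ?thesis using r s by force
  qed
  have "body_radius (lattice_of A) V = r"
    unfolding body_radius_def D_def[symmetric]
    by (rule the_equality) (use r \<open>r \<noteq> 0\<close> uniq in auto)
  then show ?thesis using that[of p] p r \<open>r \<noteq> 0\<close> by simp
qed

subsection \<open>Lattice-free bodies\<close>

text \<open>Minkowski's argument: half of \<open>x - y\<close> is a lattice point and also the
  midpoint of \<open>x\<close> and \<open>- y\<close>, hence interior to \<open>K\<close> and so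
  0.\<close>

lemma lattice_free_body_incongruent:
  assumes K: "K \<in> lattice_free_bodies L"
    and xy: "x \<in> interior K" "y \<in> interior K" "x - y \<in> (*\<^sub>R) 2 ` L"
  shows "x = y"
proof -
  obtain l where l: "l \<in> L" "x - y = 2 *\<^sub>R l" using xy by auto
  have sym: "uminus ` K = K" and "convex K" and free: "interior K \<inter> L \<subseteq> {0}"
    using K by (auto simp: lattice_free_bodies_def)
  have "- y \<in> interior K" using xy(2) sym interior_negations[of K] by auto
  then have "(1/2) *\<^sub>R x + (1/2) *\<^sub>R (- y) \<in> interior K"
    using convexD[OF convex_interior[OF \<open>convex K\<close>] xy(1), of "- y" "1/2" "1/2"] by simp
  also have "(1/2) *\<^sub>R x + (1/2) *\<^sub>R (- y) = (1/2) *\<^sub>R (x - y)" by (simp add: algebra_simps)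
  also have "\<dots> = l" by (simp add: l)
  finally show ?thesis using free l by auto
qed

text \<open>Incongruence holds only in the interior of \<open>K\<close>, which has full volume since
  the frontier of a convex set is negligible. Reduction modulo \<open>2L\<close> does not increase
  norms and so stays in the ball of radius \<open>R\<close>.\<close>

lemma measure_lattice_free_body_le:
  assumes A: "invertible (A :: real^'n^'n)" and K: "K \<in> lattice_free_bodies (lattice_of A)"
    and R: "K \<subseteq> cball 0 R"
  shows "measure lebesgue K
    \<le> measure lebesgue (cball 0 R \<inter> dirichlet_voronoi ((*\<^sub>R) 2 ` lattice_of A))"
proof -
  have inv2: "invertible (2 *\<^sub>R A)" using A by (simp add: invertible_det_nz det_scaleR)
  have "compact K" "convex K" using K by (auto simp: lattice_free_bodies_def)
  then have "measure lebesgue K = measure lebesgue (interior K)"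
    using measure_interior[of K] by (simp add: compact_imp_bounded negligible_convex_frontier)
  also have "\<dots> \<le> measure lebesgue (cball 0 R \<inter> dirichlet_voronoi (lattice_of (2 *\<^sub>R A)))"
  proof (rule measure_le_if_incongruent[OF countable_lattice_of diff_in_lattice_of])
    show "interior K \<in> lmeasurable"
      using \<open>compact K\<close> by (simp add: compact_imp_bounded lmeasurable_interior)
    show "cball 0 R \<inter> dirichlet_voronoi (lattice_of (2 *\<^sub>R A)) \<in> lmeasurable"
      by (intro lmeasurable_compact compact_Int_closed closed_dirichlet_voronoi compact_cball)
    show "x = y" if "x \<in> interior K" "y \<in> interior K" "x - y \<in> lattice_of (2 *\<^sub>R A)" for x y
      using that lattice_free_body_incongruent[OF K] by (simp add: scaled_lattice_of)
    show "\<exists>y\<in>lattice_of (2 *\<^sub>R A). x - y \<in> cball 0 R \<inter> dirichlet_voronoi (lattice_of (2 *\<^sub>R A))"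
      if "x \<in> interior K" for x
    proof -
      have "norm x \<le> R" using that R interior_subset[of K] by auto
      then show ?thesis
        using lattice_of_reduction[OF inv2, of x] by (fastforce intro: order_trans)
    qed
  qed
  finally show ?thesis by (simp add: scaled_lattice_of)
qed

theorem theorem2p1:
  fixes L K :: "(real^'n) set" and V :: real
  assumes "CARD('n) \<ge> 2"
    and "full_rank_lattice L"
    and "0 < V" and "V \<le> 2 ^ CARD('n) * lattice_det L"
    and "K \<in> lattice_free_bodies L"
    and "measure lebesgue K = V"
  shows "diameter (extremal_body L V) \<le> diameter K"
proof -
  obtain A where A: "invertible A" and L: "L = lattice_of A"
    using assms(2) by (auto simp: full_rank_lattice_def)
  define D where "D = dirichlet_voronoi ((*\<^sub>R) 2 ` L)"
  define r where "r = body_radius L V"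
  obtain p where p: "p \<in> D" "r \<le> norm p" "0 < r" "measure lebesgue (cball 0 r \<inter> D) = V"
    using measure_body_radius[OF A, of V] assms(3,4) by (auto simp: L r_def D_def lattice_det_eq[OF A])
  have K: "compact K" "uminus ` K = K" using assms(5) by (simp_all add: lattice_free_bodies_def)
  have "K \<noteq> {}" using assms(3,6) by auto
  obtain x where x: "x \<in> K" "\<forall>y\<in>K. norm y \<le> norm x" "diameter K = 2 * norm x"
    using diameter_eq_twice_Sup_norm[OF K(1) \<open>K \<noteq> {}\<close> K(2)] by blast
  have "K \<subseteq> cball 0 (norm x)" using x by auto
  then have V: "V \<le> measure lebesgue (cball 0 (norm x) \<inter> D)"
    using measure_lattice_free_body_le[OF A, of K "norm x"] assms(5,6) by (simp add: L D_def)
  \<comment> \<open>Otherwise strict monotonicity, with \<open>p\<close> as the far point of the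
    cell, would make the volume at radius \<open>norm x\<close> smaller than
    \<open>V\<close>.\<close>
  have "r \<le> norm x"
  proof (rule ccontr)
    assume "\<not> r \<le> norm x"
    moreover have "D = dirichlet_voronoi (lattice_of (2 *\<^sub>R A))" "invertible (2 *\<^sub>R A)"
      using A by (simp_all add: D_def L scaled_lattice_of invertible_det_nz det_scaleR)
    ultimately have "measure lebesgue (cball 0 (norm x) \<inter> D) < measure lebesgue (cball 0 r \<inter> D)"
      using p by (intro measure_cball_Int_strict_mono[of D p])
        (auto simp: closed_dirichlet_voronoi convex_dirichlet_voronoi
          interior_dirichlet_voronoi_lattice_of)
    with V p show False by simp
  qed
  moreover have "diameter (extremal_body L V) \<le> 2 * r"
  proof (rule diameter_le)
    fix y z assume "y \<in> extremal_body L V" "z \<in> extremal_body L V"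
    then show "norm (y - z) \<le> 2 * r"
      using norm_triangle_ineq4[of y z] by (auto simp: extremal_body_def r_def)
  qed (use p in auto)
  ultimately show ?thesis using x by linarith
qed

end
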